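(* Let $d,k,m\ge1$, $W_1\in\mathbb{R}^{m\times d}$, $b_1\in\mathbb{R}^m$, $W_2\in\mathbb{R}^{k\times m}$, $b_2\in\mathbb{R}^k$, let $\phi:\mathbb{R}\to\mathbb{R}$ be twice differentiable, and let $g_\theta(x)=W_2\,\phi(W_1x+b_1)+b_2$ for $x\in\mathbb{R}^d$, with $\phi$ applied coordinatewise. Let $w_j\in\mathbb{R}^d$ be the (transposed) $j$-th row of $W_1$ and $v_j\in\mathbb{R}^k$ the $j$-th column of $W_2$. For $c\in\mathbb{R}^k$ let $s_c(x)=c^\top g_\theta(x)$. Then for every $c\in\mathbb{R}^k$ and every $x\in\mathbb{R}^d$, $$\nabla_x^2 s_c(x)=\sum_{j=1}^m (c^\top v_j)\,\phi''(w_j^\top x+b_{1,j})\,w_jw_j^\top .$$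
   Context: $b_{1,j}$ denotes the $j$-th coordinate of $b_1$; $\nabla_x^2$ denotes the Hessian matrix with respect to $x$. *)

theory Defs
  imports "HOL-Analysis.Analysis"
begin

text \<open>The network \<open>g\<^sub>\<theta>(x) = W\<^sub>2 \<phi>(W\<^sub>1 x + b\<^sub>1) + b\<^sub>2\<close>, where \<open>\<theta> = (W\<^sub>1, b\<^sub>1, W\<^sub>2, b\<^sub>2)\<close>.\<close>

definition network ::
  "(real \<Rightarrow> real) \<Rightarrow> real^'d^'m \<Rightarrow> real^'m \<Rightarrow> real^'m^'k \<Rightarrow> real^'k \<Rightarrow> real^'d \<Rightarrow> real^'k"
  where "network \<phi> W\<^sub>1 b\<^sub>1 W\<^sub>2 b\<^sub>2 x = W\<^sub>2 *v (\<chi> j. \<phi> ((W\<^sub>1 *v x + b\<^sub>1) $ j)) + b\<^sub>2"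

definition score ::
  "(real \<Rightarrow> real) \<Rightarrow> real^'d^'m \<Rightarrow> real^'m \<Rightarrow> real^'m^'k \<Rightarrow> real^'k \<Rightarrow> real^'k \<Rightarrow> real^'d \<Rightarrow> real"
  where "score \<phi> W\<^sub>1 b\<^sub>1 W\<^sub>2 b\<^sub>2 c x = c \<bullet> network \<phi> W\<^sub>1 b\<^sub>1 W\<^sub>2 b\<^sub>2 x"

definition partial_deriv :: "'n \<Rightarrow> (real^'n \<Rightarrow> real) \<Rightarrow> real^'n \<Rightarrow> real"
  where "partial_deriv i f x = deriv (\<lambda>t. f (x + t *\<^sub>R axis i 1)) 0"

text \<open>
  Since \<^const>\<open>deriv\<close> is total, \<open>hessian f x\<close> is the Hessian matrix only where the second
  derivative exists; \<open>twice_differentiable_at\<close> below expresses that it does.  Differentiability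
  of the derivative map at \<open>x\<close> is stated through its components, the partial derivatives.
\<close>

definition hessian :: "(real^'n \<Rightarrow> real) \<Rightarrow> real^'n \<Rightarrow> real^'n^'n"
  where "hessian f x = (\<chi> i j. partial_deriv i (partial_deriv j f) x)"

definition twice_differentiable_at :: "(real^'n \<Rightarrow> real) \<Rightarrow> real^'n \<Rightarrow> bool"
  where "twice_differentiable_at f x \<longleftrightarrow>
    (\<forall>\<^sub>F y in nhds x. f differentiable (at y)) \<and>
    (\<forall>i. partial_deriv i f differentiable (at x))"

end

theory Submission
  imports Defs
begin

text \<open>Call \<open>(\<Sum>j\<in>J. a j * \<psi> (w j \<bullet> x + \<beta> j)) + C\<close> a
  ridge sum. The score is one, with \<open>\<psi> = \<phi>\<close>
  (\<open>score_eq_ridge_sum\<close>), and ridge sums are closed under partial derivatives: by the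
  chain rule, differentiating along the i-th axis replaces \<open>\<psi>\<close> by
  \<open>deriv \<psi>\<close>, \<open>a j\<close> by \<open>a j * w j $ i\<close> and
  \<open>C\<close> by 0 (\<open>partial_deriv_ridge_sum\<close>). Doing this twice gives each
  Hessian entry, and the two factors collected from \<open>w j\<close> are an entry of its outer
  product with itself.\<close>

text \<open>Chain rule along the line through \<open>x\<close> in direction \<open>axis i 1\<close>;
  linearity of \<open>f'\<close> turns the derivative in \<open>t\<close> into multiplication by a
  constant. This links the total function \<open>deriv\<close> to a derivative known to
  exist.\<close>

lemma partial_deriv_eq:
  assumes "(f has_derivative f') (at x)"
  shows "partial_deriv i f x = f' (axis i 1)"
proof -
  have lin: "linear f'"
    using assms by (rule has_derivative_linear)
  have "((\<lambda>t. f (x + t *\<^sub>R axis i 1)) has_derivative (\<lambda>t. f' (t *\<^sub>R axis i 1))) (at 0)"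
    by (rule has_derivative_compose[where g = f]) (auto intro!: derivative_eq_intros assms)
  then have "((\<lambda>t. f (x + t *\<^sub>R axis i 1)) has_field_derivative f' (axis i 1)) (at 0)"
    by (simp add: has_field_derivative_def linear_scale[OF lin] mult_commute_abs)
  then show ?thesis
    unfolding partial_deriv_def by (rule DERIV_imp_deriv)
qed

text \<open>The full derivative is needed, since \<open>twice_differentiable_at\<close> asks for
  more than partial derivatives. Leaving \<open>\<psi>\<close>, \<open>a\<close> and
  \<open>C\<close> arbitrary lets the lemma serve both orders of differentiation.\<close>

lemma has_derivative_ridge_sum:
  fixes w :: "'j \<Rightarrow> 'a::real_inner"
  assumes "\<And>t. \<psi> differentiable (at t)"
  shows "((\<lambda>x. (\<Sum>j\<in>J. a j * \<psi> (w j \<bullet> x + \<beta> j)) + C) has_derivative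
    (\<lambda>h. \<Sum>j\<in>J. a j * (deriv \<psi> (w j \<bullet> x + \<beta> j) * (w j \<bullet> h)))) (at x)"
proof -
  have "((\<lambda>x. \<psi> (w j \<bullet> x + \<beta> j)) has_derivative
      (\<lambda>h. deriv \<psi> (w j \<bullet> x + \<beta> j) * (w j \<bullet> h))) (at x)" for j
  proof (rule has_derivative_compose[where g = \<psi>
        and g' = "(*) (deriv \<psi> (w j \<bullet> x + \<beta> j))"])
    show "((\<lambda>x. w j \<bullet> x + \<beta> j) has_derivative (\<lambda>h. w j \<bullet> h)) (at x)"
      by (auto intro!: derivative_eq_intros)
    show "(\<psi> has_derivative (*) (deriv \<psi> (w j \<bullet> x + \<beta> j))) (at (w j \<bullet> x + \<beta> j))"
      using assms by (simp add: DERIV_deriv_iff_real_differentiable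
        flip: has_field_derivative_def)
  qed
  then show ?thesis
    by (auto intro!: derivative_eq_intros)
qed

lemma partial_deriv_ridge_sum:
  fixes w :: "'j \<Rightarrow> real^'n"
  assumes "\<And>t. \<psi> differentiable (at t)"
  shows "partial_deriv i (\<lambda>x. (\<Sum>j\<in>J. a j * \<psi> (w j \<bullet> x + \<beta> j)) + C) x =
    (\<Sum>j\<in>J. (a j * w j $ i) * deriv \<psi> (w j \<bullet> x + \<beta> j))"
  unfolding partial_deriv_eq[OF has_derivative_ridge_sum[OF assms]]
  by (simp add: inner_axis mult_ac)

text \<open>A matrix times a vector is the combination of the columns weighted by the vector's
  coordinates; the inner product with \<open>c\<close> then acts on each column.\<close>

lemma score_eq_ridge_sum:
  "score \<phi> W\<^sub>1 b\<^sub>1 W\<^sub>2 b\<^sub>2 c x =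
    (\<Sum>j\<in>UNIV. (c \<bullet> column j W\<^sub>2) * \<phi> (row j W\<^sub>1 \<bullet> x + b\<^sub>1 $ j)) + c \<bullet> b\<^sub>2"
  by (simp add: score_def network_def matrix_mult_sum[of W\<^sub>2] inner_add_right inner_sum_right
    scalar_mult_eq_scaleR matrix_vector_mul_component row_def vec_nth_inverse mult.commute)

text \<open>The inner dimension is the one-element type \<open>1\<close>, so the sum defining the
  product has a single term.\<close>

lemma columnvector_mult_rowvector_nth:
  "(columnvector u ** (rowvector v :: 'a::semiring_1^'n^1)) $ i $ j = u $ i * v $ j"
  by (simp add: columnvector_def rowvector_def matrix_matrix_mult_def)

theorem lemma2:
  fixes W\<^sub>1 :: "real^'d^'m" and b\<^sub>1 :: "real^'m"
    and W\<^sub>2 :: "real^'m^'k" and b\<^sub>2 :: "real^'k"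
    and \<phi> :: "real \<Rightarrow> real" and c :: "real^'k" and x :: "real^'d"
  assumes "\<And>t. \<phi> differentiable (at t)"
    and "\<And>t. deriv \<phi> differentiable (at t)"
  shows "twice_differentiable_at (score \<phi> W\<^sub>1 b\<^sub>1 W\<^sub>2 b\<^sub>2 c) x \<and>
    hessian (score \<phi> W\<^sub>1 b\<^sub>1 W\<^sub>2 b\<^sub>2 c) x =
      (\<Sum>j\<in>UNIV. ((c \<bullet> column j W\<^sub>2) * deriv (deriv \<phi>) (row j W\<^sub>1 \<bullet> x + b\<^sub>1 $ j)) *\<^sub>R
        (columnvector (row j W\<^sub>1) ** (rowvector (row j W\<^sub>1) :: real^'d^1)))"
proof
  let ?s = "score \<phi> W\<^sub>1 b\<^sub>1 W\<^sub>2 b\<^sub>2 c"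
  let ?a = "\<lambda>j. c \<bullet> column j W\<^sub>2"
  let ?w = "\<lambda>j. row j W\<^sub>1"
  have s: "?s = (\<lambda>x. (\<Sum>j\<in>UNIV. ?a j * \<phi> (?w j \<bullet> x + b\<^sub>1 $ j)) + c \<bullet> b\<^sub>2)"
    by (intro ext score_eq_ridge_sum)
  \<comment> \<open>The summand 0 plays the part of \<open>C\<close>, so that the ridge sum lemmas
    match once more, now with \<open>deriv \<phi>\<close>.\<close>
  have ds: "partial_deriv i ?s =
      (\<lambda>x. (\<Sum>j\<in>UNIV. (?a j * ?w j $ i) * deriv \<phi> (?w j \<bullet> x + b\<^sub>1 $ j)) + 0)" for i
    unfolding s by (rule ext) (simp add: partial_deriv_ridge_sum[OF assms(1)])
  have "?s differentiable (at y)" for y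
    unfolding s by (rule differentiableI[OF has_derivative_ridge_sum[OF assms(1)]])
  moreover have "partial_deriv i ?s differentiable (at x)" for i
    unfolding ds by (rule differentiableI[OF has_derivative_ridge_sum[OF assms(2)]])
  ultimately show "twice_differentiable_at ?s x"
    by (simp add: twice_differentiable_at_def)
  show "hessian ?s x =
      (\<Sum>j\<in>UNIV. (?a j * deriv (deriv \<phi>) (?w j \<bullet> x + b\<^sub>1 $ j)) *\<^sub>R
        (columnvector (?w j) ** (rowvector (?w j) :: real^'d^1)))"
    \<comment> \<open>Both sides are compared entrywise; the coordinates of \<open>?w j\<close> from
      the inner and outer derivative commute, so the order of differentiation is immaterial.\<close>
    unfolding hessian_def ds partial_deriv_ridge_sum[OF assms(2)]
    by (simp add: vec_eq_iff columnvector_mult_rowvector_nth mult_ac)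
qed

end
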